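(* Let $q$ be a real number with $0<q<1$, and let $a_1,a_2,a_3\in\mathbb{C}$ with $\Re(a_i)>0$ for $1\le i\le 3$. For $1\le i<j\le 3$ put $a_{ij}:=a_k$ where $\{k\}=\{1,2,3\}\setminus\{i,j\}$. Then $$ \frac{1}{(2\pi i)^3}\int_{T^3} \prod_{1\leq i < j\leq 3} (y_i/y_j;q)_{a_{ij}}\,(q\,y_j/y_i;q)_{a_{ij}}\, \frac{dy_1}{y_1}\frac{dy_2}{y_2}\frac{dy_3}{y_3} = \frac{\Gamma_q(a_1+a_2+a_3+1)\prod_{i=1}^3 \Gamma_q(2a_i+1)}{\prod_{i=1}^3 \Gamma_q(a_i+1)\prod_{1\leq i< j\leq 3}\Gamma_q(a_i+a_j+1)}. $$
   Context: $T^3=\{(y_1,y_2,y_3)\in\mathbb{C}^3 : |y_i|=1,\ 1\le i\le 3\}$, each circle being oriented counterclockwise (in the prefactor $1/(2\pi i)^3$, $i$ is the imaginary unit). For $x\in\mathbb{C}$, $(x;q)_\infty=\prod_{i=0}^\infty(1-xq^i)$, and for $x,a\in\mathbb{C}$, $(x;q)_a=\frac{(x;q)_\infty}{(xq^a;q)_\infty}$, where $q^a=e^{a\log q}$ with $\log q$ real. The $q$-Gamma function is $\Gamma_q(x)=(1-q)^{1-x}\frac{(q;q)_\infty}{(q^x;q)_\infty}$. *)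

theory Defs
  imports "HOL-Complex_Analysis.Complex_Analysis"
begin

definition q_poch_inf :: "real \<Rightarrow> complex \<Rightarrow> complex" where
  "q_poch_inf q x = (\<Prod>i. 1 - x * of_real q ^ i)"

text \<open>For \<open>0 < q\<close> the principal power \<open>of_real q powr a\<close> is \<open>exp (a * of_real (ln q))\<close>.\<close>

definition q_poch :: "real \<Rightarrow> complex \<Rightarrow> complex \<Rightarrow> complex" where
  "q_poch q x a = q_poch_inf q x / q_poch_inf q (x * of_real q powr a)"

definition q_Gamma :: "real \<Rightarrow> complex \<Rightarrow> complex" where
  "q_Gamma q x =
     of_real (1 - q) powr (1 - x) * q_poch_inf q (of_real q) / q_poch_inf q (of_real q powr x)"

text \<open>
  The integral of \<open>f(y\<^sub>1,\<dots>,y\<^sub>n) dy\<^sub>1 \<dots> dy\<^sub>n\<close> over the \<open>n\<close>-fold product of the unit circle,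
  each factor oriented counterclockwise: the pullback of the form along the parametrisation
  \<open>y\<^sub>i = circlepath 0 1 t\<^sub>i = exp (2 pi \<i> t\<^sub>i)\<close>, integrated over the cube \<open>[0,1]\<^sup>n\<close> with respect
  to product Lebesgue measure. The coordinates are indexed by \<open>1, \<dots>, n\<close>.
\<close>

definition torus_integral :: "nat \<Rightarrow> ((nat \<Rightarrow> complex) \<Rightarrow> complex) \<Rightarrow> complex" where
  "torus_integral n f =
     (LINT t | Pi\<^sub>M {1..n} (\<lambda>_. restrict_space lborel {0..1}).
        f (\<lambda>i. circlepath 0 1 (t i)) *
        (\<Prod>i=1..n. vector_derivative (circlepath 0 1) (at (t i))))"

definition third_index :: "nat \<Rightarrow> nat \<Rightarrow> nat" where
  "third_index i j = the_elem ({1,2,3} - {i,j})"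

definition index_pairs :: "(nat \<times> nat) set" where
  "index_pairs = {(i, j). 1 \<le> i \<and> i < j \<and> j \<le> 3}"

end

(*
  Put z_i = q^(a_i) and f_z(x) = (x;q)(q/x;q) / ((zx;q)(zq/x;q)), all products infinite. By the
  q-binomial theorem f_z is a product of a power series in x and one in 1/x; its Laurent coefficients
  are sums of q-Gauss type, with c_k(z) = c_0(z) * prod_{i<k} (z - q^i)/(1 - z q^(i+1)) and
  c_{-k} = q^k c_k for k >= 0. Integrating over the torus leaves
  sum_k c_k(z_3) c_k(z_1) c_{-k}(z_2), a nonterminating q-Dixon sum. Both this sum and the q-Gauss sum
  satisfy a first-order recursion under multiplication of one parameter by q, proved by telescoping;
  iterating sends that parameter to 0 and yields the product formula up to the value at 0. For
  q-Dixon this value is read off at z_1 = 1, where all terms but one vanish.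
*)

theory Submission
  imports Defs
begin

text \<open>Everything is arranged so that a parameter can both tend to 0 and start on the unit
  circle. The products use the factors z - q^i in place of the usual z^n (1/z;q)_n, so nothing is
  divided by z, and the denominators are products of 1 - s q^(i+1), which stay away from 0 for |s|
  <= 1. A single constant bounds all these quotients; together with the power of q in every summand
  of the Gauss and Dixon sums it gives dominated convergence as the parameter is multiplied by q
  again and again. The value reached at 0 is the same for every starting point, so any convenient
  start determines it. For this reason the Dixon recursion is set up on the closed disc, although
  the parameters q^(a_i) have modulus below 1: the start 1 has to be admissible. The Gauss sum needs
  no such detour, since at 0 it becomes a q-binomial series.\<close>

lemma prod_recursion_limit:
  fixes h a b :: "nat \<Rightarrow> 'a :: real_normed_field"
  assumes rec: "\<And>n. h n * b n = a n * h (Suc n)"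
    and b: "(\<lambda>n. \<Prod>i<n. b i) \<longlonglongrightarrow> B" and a: "(\<lambda>n. \<Prod>i<n. a i) \<longlonglongrightarrow> A"
    and h: "h \<longlonglongrightarrow> L"
  shows "h 0 * B = A * L"
proof -
  \<comment> \<open>Staying in cross-multiplied form means that no factor has to be nonzero; the
    q-binomial recursion at x = 1 begins with a vanishing \<open>a 0\<close>.\<close>
  have eq: "h 0 * (\<Prod>i<n. b i) = (\<Prod>i<n. a i) * h n" for n
  proof (induction n)
    case (Suc n)
    have "h 0 * (\<Prod>i<Suc n. b i) = (h 0 * (\<Prod>i<n. b i)) * b n" by simp
    also have "\<dots> = (\<Prod>i<n. a i) * (h n * b n)" by (simp only: Suc mult.assoc)
    also have "\<dots> = (\<Prod>i<Suc n. a i) * h (Suc n)" by (simp add: rec mult.assoc)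
    finally show ?case .
  qed simp
  have "(\<lambda>n. h 0 * (\<Prod>i<n. b i)) \<longlonglongrightarrow> h 0 * B" by (intro tendsto_intros b)
  moreover have "(\<lambda>n. (\<Prod>i<n. a i) * h n) \<longlonglongrightarrow> A * L" by (intro tendsto_intros a h)
  ultimately show ?thesis unfolding eq by (rule LIMSEQ_unique)
qed

lemma tendsto_suminf_dominated:
  fixes f :: "nat \<Rightarrow> nat \<Rightarrow> 'a :: {real_normed_algebra, banach}"
  assumes "\<And>k. (\<lambda>n. f k n) \<longlonglongrightarrow> g k" and "\<And>k n. norm (f k n) \<le> M k" and "summable M"
  shows "(\<lambda>n. \<Sum>k. f k n) \<longlonglongrightarrow> (\<Sum>k. g k)"
  using tannerys_theorem[of f g sequentially M] assms by (simp add: case_prod_unfold)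

section \<open>Infinite q-products and the q-binomial theorem\<close>

locale q_base =
  fixes q :: real
  assumes q_pos: "0 < q" and q_less_1: "q < 1"
begin

abbreviation "Q \<equiv> complex_of_real q"
abbreviation "qp \<equiv> q_poch_inf q"

lemma abs_q [simp]: "\<bar>q\<bar> = q"
  using q_pos by simp

lemma Q_nonzero [simp]: "Q \<noteq> 0"
  using q_pos by simp

lemma Q_power_tendsto_0: "(\<lambda>n. Q ^ n) \<longlonglongrightarrow> 0"
  by (intro LIMSEQ_power_zero) (simp add: q_less_1)

lemma q_power_le_1: "q ^ n \<le> 1"
  using q_pos q_less_1 by (simp add: power_le_one)

lemma q_power_Suc_less_1: "q ^ Suc n < 1"
  using q_pos q_less_1 by (rule power_Suc_less_one)

lemma norm_Q_power [simp]: "norm (Q ^ n) = q ^ n"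
  by (simp add: norm_power)

lemma norm_mult_Q_power_le_1: "norm x \<le> 1 \<Longrightarrow> norm (x * Q ^ n) \<le> 1"
  unfolding norm_mult norm_Q_power
  using q_pos mult_mono[of "norm x" 1 "q ^ n" 1] q_power_le_1 by simp

lemma norm_mult_Q_power_less_1: "norm x < 1 \<Longrightarrow> norm (x * Q ^ n) < 1"
  unfolding norm_mult norm_Q_power
  using q_pos mult_left_le[OF q_power_le_1[of n], of "norm x"] by simp

lemma norm_mult_Q_power_Suc_less_1: "norm x \<le> 1 \<Longrightarrow> norm (x * Q ^ Suc n) < 1"
  unfolding norm_mult norm_Q_power
  using q_pos q_power_Suc_less_1[of n]
  by (intro le_less_trans[OF mult_left_le_one_le[of "q ^ Suc n" "norm x"]]) simp_all

lemma one_minus_nonzero: "norm x < 1 \<Longrightarrow> 1 - x \<noteq> (0 :: complex)"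
  by auto

lemma one_minus_Q_power_nonzero: "norm x \<le> 1 \<Longrightarrow> 1 - x * Q ^ Suc n \<noteq> 0"
  using one_minus_nonzero norm_mult_Q_power_Suc_less_1 by blast

lemma convergent_prod_qp: "convergent_prod (\<lambda>i. 1 - x * Q ^ i)"
proof (intro abs_convergent_prod_imp_convergent_prod summable_imp_abs_convergent_prod)
  show "summable (\<lambda>i. norm (1 - x * Q ^ i - 1))"
    using q_pos q_less_1 by (simp add: norm_mult summable_geometric)
qed

lemma qp_tendsto: "(\<lambda>n. \<Prod>i<n. 1 - x * Q ^ i) \<longlonglongrightarrow> qp x"
  using convergent_prod_LIMSEQ[OF convergent_prod_qp, of x]
  by (simp add: q_poch_inf_def LIMSEQ_lessThan_iff_atMost)

lemma qp_nonzero: "norm x < 1 \<Longrightarrow> qp x \<noteq> 0"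
  unfolding q_poch_inf_def
  by (intro prodinf_nonzero convergent_prod_qp one_minus_nonzero norm_mult_Q_power_less_1)

lemma qp_Q_nonzero: "norm x \<le> 1 \<Longrightarrow> qp (x * Q) \<noteq> 0"
  using qp_nonzero[of "x * Q"] norm_mult_Q_power_Suc_less_1[of x 0] by simp

lemma qp_split: "qp x = (\<Prod>i<n. 1 - x * Q ^ i) * qp (x * Q ^ n)"
proof -
  have "qp x = prodinf (\<lambda>i. 1 - x * Q ^ i)" by (simp add: q_poch_inf_def)
  also have "\<dots> = (\<Prod>i<n. 1 - x * Q ^ i) * (\<Prod>i. 1 - x * Q ^ (i + n))" if nz: "\<And>i. i < n \<Longrightarrow> 1 - x * Q ^ i \<noteq> 0"
    using prodinf_split_initial_segment[OF convergent_prod_qp, of n x] nz by simp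
  also have "(\<Prod>i. 1 - x * Q ^ (i + n)) = qp (x * Q ^ n)"
    by (simp add: q_poch_inf_def power_add mult_ac)
  finally have *: "qp x = (\<Prod>i<n. 1 - x * Q ^ i) * qp (x * Q ^ n)" if "\<And>i. i < n \<Longrightarrow> 1 - x * Q ^ i \<noteq> 0"
    using that by blast
  show ?thesis
  \<comment> \<open>If one of the first n factors vanishes, it occurs in all later partial products,
    so both sides are 0.\<close>
  proof (cases "\<forall>i<n. 1 - x * Q ^ i \<noteq> 0")
    case False
    then obtain j where j: "j < n" "1 - x * Q ^ j = 0" by blast
    have "(\<lambda>n. \<Prod>i<n. 1 - x * Q ^ i) \<longlonglongrightarrow> 0"
    proof (rule tendsto_eventually, rule eventually_sequentiallyI[of "Suc j"])
      show "(\<Prod>i<m. 1 - x * Q ^ i) = 0" if "m \<ge> Suc j" for m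
        using that j by auto
    qed
    hence "qp x = 0" using qp_tendsto LIMSEQ_unique by blast
    moreover have "(\<Prod>i<n. 1 - x * Q ^ i) = 0" using j by auto
    ultimately show ?thesis by simp
  qed (use * in blast)
qed

text \<open>
  Independent \<open>t\<close> and \<open>s\<close> cover all the product quotients below: \<open>t = s = 1\<close> for the q-binomial
  coefficients, \<open>t = s = q\<^sup>k\<close> for their ratios, and \<open>t = 1\<close>, \<open>s = z\<close> for the Laurent coefficients.
\<close>

definition qquot :: "complex \<Rightarrow> complex \<Rightarrow> complex \<Rightarrow> nat \<Rightarrow> complex" where
  "qquot z t s n = (\<Prod>i<n. (z - t * Q ^ i) / (1 - s * Q ^ Suc i))"

lemma qquot_0 [simp]: "qquot z t s 0 = 1"
  by (simp add: qquot_def)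

lemma qquot_Suc: "qquot z t s (Suc n) = qquot z t s n * (z - t * Q ^ n) / (1 - s * Q ^ Suc n)"
  by (simp add: qquot_def)

text \<open>On the closed unit disc the numerators are at most 1 + q^i and the denominators at least
  1 - q^(i+1), so the convergent quotients (-1;q)_n / (q;q)_n dominate. What matters is that
  \<open>K\<close> depends neither on n nor on the parameters.\<close>

lemma qquot_bounded:
  obtains K where "\<And>z t s n. norm z \<le> 1 \<Longrightarrow> norm t \<le> 1 \<Longrightarrow> norm s \<le> 1 \<Longrightarrow> norm (qquot z t s n) \<le> K"
    and "K > 0"
proof -
  let ?p = "\<lambda>n. (\<Prod>i<n. 1 - (-1) * Q ^ i) / (\<Prod>i<n. 1 - Q * Q ^ i)"
  have "?p \<longlonglongrightarrow> qp (-1) / qp Q"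
    by (intro tendsto_divide qp_tendsto qp_nonzero) (use q_less_1 in simp)
  hence "Bseq ?p" by (intro convergent_imp_Bseq convergentI)
  then obtain K where K: "K > 0" "\<And>n. norm (?p n) \<le> K" by (auto simp: Bseq_def)
  show thesis
  proof (rule that[of K])
    fix z t s :: complex and n
    assume *: "norm z \<le> 1" "norm t \<le> 1" "norm s \<le> 1"
    have "norm (qquot z t s n) = (\<Prod>i<n. norm (z - t * Q ^ i) / norm (1 - s * Q ^ Suc i))"
      unfolding qquot_def prod_norm[symmetric] norm_divide ..
    also have "\<dots> \<le> (\<Prod>i<n. (1 + q ^ i) / (1 - q ^ Suc i))"
    proof (intro prod_mono conjI frac_le)
      fix i
      have "norm (z - t * Q ^ i) \<le> norm z + norm (t * Q ^ i)" by (rule norm_triangle_ineq4)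
      also have "norm (t * Q ^ i) \<le> q ^ i"
        using * q_pos mult_left_le_one_le[of "q ^ i" "norm t"] by (simp add: norm_mult norm_power)
      finally show "norm (z - t * Q ^ i) \<le> 1 + q ^ i" using * by simp
      have "norm (s * Q ^ Suc i) \<le> q ^ Suc i"
        unfolding norm_mult norm_Q_power using * q_pos mult_left_le_one_le[of "q ^ Suc i" "norm s"]
            by simp
      thus "1 - q ^ Suc i \<le> norm (1 - s * Q ^ Suc i)"
        using norm_triangle_ineq2[of 1 "s * Q ^ Suc i"] by simp
      show "0 < 1 - q ^ Suc i" using q_power_Suc_less_1[of i] by simp
    qed (use q_pos in auto)
    also have "\<dots> = (\<Prod>i<n. norm (1 - (-1) * Q ^ i) / norm (1 - Q * Q ^ i))"
    proof (intro prod.cong refl arg_cong2[where f = "(/)"])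
      fix i
      have "norm (complex_of_real (1 + q ^ i)) = 1 + q ^ i" using q_pos by (subst norm_of_real) simp
      thus "1 + q ^ i = norm (1 - (-1) * Q ^ i)" by simp
      have "norm (complex_of_real (1 - q ^ Suc i)) = 1 - q ^ Suc i"
        using q_power_Suc_less_1[of i] by (subst norm_of_real) simp
      thus "1 - q ^ Suc i = norm (1 - Q * Q ^ i)" by simp
    qed
    also have "\<dots> = norm (?p n)" unfolding norm_divide prod_norm[symmetric] prod_dividef ..
    also have "\<dots> \<le> K" by (rule K)
    finally show "norm (qquot z t s n) \<le> K" .
  qed (rule K)
qed

text \<open>One limit for each recursion: the Gauss recursion shrinks t and s with z fixed, the
  Dixon recursion shrinks z and s with t fixed.\<close>

lemma qquot_tendsto:
  "((\<lambda>n. qquot z (t * Q ^ n) (s * Q ^ n) k) \<longlonglongrightarrow> z ^ k)"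
  "((\<lambda>n. qquot (z * Q ^ n) t (s * Q ^ n) k) \<longlonglongrightarrow> qquot 0 t 0 k)"
proof -
  have s: "(\<lambda>n. s * Q ^ n) \<longlonglongrightarrow> 0" and t: "(\<lambda>n. t * Q ^ n) \<longlonglongrightarrow> 0" and z: "(\<lambda>n. z * Q ^ n) \<longlonglongrightarrow> 0"
    using tendsto_mult_right_zero[OF Q_power_tendsto_0] by blast+
  have "((\<lambda>n. \<Prod>i<k. (z - (t * Q ^ n) * Q ^ i) / (1 - s * Q ^ n * Q ^ Suc i)) \<longlonglongrightarrow>
    (\<Prod>i<k. (z - 0 * Q ^ i) / (1 - 0 * Q ^ Suc i)))"
    by (intro tendsto_prod tendsto_divide tendsto_diff tendsto_mult tendsto_const s t) auto
  thus "((\<lambda>n. qquot z (t * Q ^ n) (s * Q ^ n) k) \<longlonglongrightarrow> z ^ k)"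
    by (simp add: qquot_def)
  have "((\<lambda>n. \<Prod>i<k. (z * Q ^ n - t * Q ^ i) / (1 - s * Q ^ n * Q ^ Suc i)) \<longlonglongrightarrow>
    (\<Prod>i<k. (0 - t * Q ^ i) / (1 - 0 * Q ^ Suc i)))"
    by (intro tendsto_prod tendsto_divide tendsto_diff tendsto_mult tendsto_const s z) auto
  thus "((\<lambda>n. qquot (z * Q ^ n) t (s * Q ^ n) k) \<longlonglongrightarrow> qquot 0 t 0 k)"
    by (simp add: qquot_def)
qed

text \<open>For z \<noteq> 0 this is z^n (1/z;q)_n / (q;q)_n, the coefficient of x^n in the
  q-binomial expansion of (x;q) / (zx;q), both products infinite.\<close>

definition qbin_coeff :: "complex \<Rightarrow> nat \<Rightarrow> complex" where
  "qbin_coeff z = qquot z 1 1"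

lemma qbin_coeff_Suc: "(1 - Q ^ Suc n) * qbin_coeff z (Suc n) = (z - Q ^ n) * qbin_coeff z n"
  using one_minus_Q_power_nonzero[of 1 n] by (simp add: qbin_coeff_def qquot_Suc)

text \<open>Ratio test: consecutive coefficients have a quotient tending to z. Hence the series
  converges absolutely on the whole circle |x| = 1, where the torus integral needs it.\<close>

lemma summable_qbin_coeff:
  assumes "norm z < 1"
  shows "summable (\<lambda>n. norm (qbin_coeff z n))"
proof -
  obtain c where c: "norm z < c" "c < 1" using assms dense by blast
  have "(\<lambda>n. (z - Q ^ n) / (1 - Q ^ Suc n)) \<longlonglongrightarrow> (z - 0) / (1 - 0)"
    by (intro tendsto_divide tendsto_diff tendsto_const Q_power_tendsto_0
        LIMSEQ_Suc[OF Q_power_tendsto_0]) simp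
  hence "(\<lambda>n. norm ((z - Q ^ n) / (1 - Q ^ Suc n))) \<longlonglongrightarrow> norm z"
    by (auto dest!: tendsto_norm)
  hence "eventually (\<lambda>n. norm ((z - Q ^ n) / (1 - Q ^ Suc n)) < c) sequentially"
    using c order_tendstoD by blast
  then obtain N where N: "\<And>n. n \<ge> N \<Longrightarrow> norm ((z - Q ^ n) / (1 - Q ^ Suc n)) < c"
    by (auto simp: eventually_sequentially)
  show ?thesis
  proof (rule summable_ratio_test[OF c(2), of N])
    fix n assume "n \<ge> N"
    have "qbin_coeff z (Suc n) = (z - Q ^ n) / (1 - Q ^ Suc n) * qbin_coeff z n"
      by (simp add: qbin_coeff_def qquot_Suc)
    hence "norm (qbin_coeff z (Suc n)) = norm ((z - Q ^ n) / (1 - Q ^ Suc n)) * norm (qbin_coeff z n)"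
      using norm_mult by metis
    also have "\<dots> \<le> c * norm (qbin_coeff z n)"
      using N[OF \<open>n \<ge> N\<close>] by (intro mult_right_mono) auto
    finally show "norm (norm (qbin_coeff z (Suc n))) \<le> c * norm (norm (qbin_coeff z n))"
      by simp
  qed
qed

lemma summable_qbin:
  assumes "norm z < 1" "norm x \<le> 1"
  shows "summable (\<lambda>n. norm (qbin_coeff z n * x ^ n))"
proof (rule summable_comparison_test'[OF summable_qbin_coeff[OF assms(1)]])
  show "norm (norm (qbin_coeff z n * x ^ n)) \<le> norm (qbin_coeff z n)" for n
    using assms(2) by (simp add: norm_mult norm_power power_le_one mult_left_le)
qed

text \<open>Comparing coefficients gives A(x) (1 - zx) = (1 - x) A(xq) for the series A. Iteration
  moves the argument to 0, where A is continuous with value 1.\<close>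

lemma q_binomial:
  assumes z: "norm z < 1" and x: "norm x \<le> 1"
  shows "(\<Sum>n. qbin_coeff z n * x ^ n) * qp (z * x) = qp x"
proof -
  define A where "A x = (\<Sum>n. qbin_coeff z n * x ^ n)" for x
  have sums: "(\<lambda>n. qbin_coeff z n * y ^ n) sums A y" if "norm y \<le> 1" for y
    unfolding A_def using summable_norm_cancel[OF summable_qbin[OF z that]] summable_sums by blast
  have rec: "A y * (1 - z * y) = (1 - y) * A (y * Q)" if y: "norm y \<le> 1" for y
  proof -
    have y': "norm (y * Q) \<le> 1" using norm_mult_Q_power_le_1[OF y, of 1] by simp
    have "(\<lambda>n. qbin_coeff z n * y ^ n - qbin_coeff z n * (y * Q) ^ n) sums (A y - A (y * Q))"
      by (intro sums_diff sums y y')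
    hence *: "(\<lambda>n. qbin_coeff z (Suc n) * y ^ Suc n - qbin_coeff z (Suc n) * (y * Q) ^ Suc n) sums
        (A y - A (y * Q))"
      using sums_Suc_iff[of "\<lambda>n. qbin_coeff z n * y ^ n - qbin_coeff z n * (y * Q) ^ n"] by simp
    have "qbin_coeff z (Suc n) * y ^ Suc n - qbin_coeff z (Suc n) * (y * Q) ^ Suc n
        = y * (z * (qbin_coeff z n * y ^ n) - qbin_coeff z n * (y * Q) ^ n)" for n
    proof -
      have "qbin_coeff z (Suc n) * y ^ Suc n - qbin_coeff z (Suc n) * (y * Q) ^ Suc n
         = ((1 - Q ^ Suc n) * qbin_coeff z (Suc n)) * y ^ Suc n"
        by (simp add: algebra_simps power_mult_distrib)
      thus ?thesis unfolding qbin_coeff_Suc by (simp add: algebra_simps power_mult_distrib)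
    qed
    moreover have "(\<lambda>n. y * (z * (qbin_coeff z n * y ^ n) - qbin_coeff z n * (y * Q) ^ n)) sums
        (y * (z * A y - A (y * Q)))"
      by (intro sums_mult sums_diff sums y y')
    ultimately have "A y - A (y * Q) = y * (z * A y - A (y * Q))"
      using * sums_unique2 by simp
    thus ?thesis by (simp add: algebra_simps)
  qed
  have "A (x * Q ^ 0) * qp (z * x) = qp x * A 0"
  proof (rule prod_recursion_limit[where h = "\<lambda>n. A (x * Q ^ n)"])
    show "A (x * Q ^ n) * (1 - z * x * Q ^ n) = (1 - x * Q ^ n) * A (x * Q ^ Suc n)" for n
      using rec[of "x * Q ^ n"] norm_mult_Q_power_le_1[OF x, of n] by (simp add: mult_ac)
    have "isCont A 0"
      unfolding A_def
      by (rule isCont_powser[of _ 1]) (use summable_norm_cancel[OF summable_qbin_coeff[OF z]] in auto)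
    moreover have "(\<lambda>n. x * Q ^ n) \<longlonglongrightarrow> 0"
      using tendsto_mult_right_zero[OF Q_power_tendsto_0] by blast
    ultimately show "(\<lambda>n. A (x * Q ^ n)) \<longlonglongrightarrow> A 0" using isCont_tendsto_compose by blast
  qed (rule qp_tendsto)+
  moreover have "A 0 = 1" by (simp add: A_def qbin_coeff_def)
  ultimately show ?thesis by (simp add: A_def)
qed

end

section \<open>The q-Gauss and q-Dixon sums\<close>

text \<open>
  Induction steps for the closed forms of the telescoped partial sums below; clearing denominators
  leaves a polynomial identity.
\<close>

lemma gauss_certificate:
  fixes t z p Q w B :: "'a :: field"
  assumes "1 - t * p \<noteq> 0" "1 - t * (p * Q) \<noteq> 0"
  shows "(1 - t * Q) * t * p * ((1 - p) * B) * w / (1 - t * p) +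
    B * p * ((z - t) * w / (1 - t * p) * (1 - t * Q) -
      (1 - t * Q) * (w * (z - t * p) / (1 - t * p)) / (1 - t * (p * Q)) * (1 - z * t * Q)) =
    (1 - t * Q) * t * (p * Q) * ((z - p) * B) * (w * (z - t * p) / (1 - t * p)) / (1 - t * (p * Q))"
proof -
  define d e where "d = 1 - t * p" and "e = 1 - t * (p * Q)"
  have nz: "d \<noteq> 0" "e \<noteq> 0" using assms by (simp_all add: d_def e_def)
  \<comment> \<open>The part of the identity left once the factor \<open>C\<close>, common to all
    terms, is taken out; it contains no fractions.\<close>
  have key: "(1 - p) * t * e + (z - t) * e - (z - t * p) * (1 - z * t * Q) =
      t * Q * (z - p) * (z - t * p)"
    unfolding e_def by algebra
  define C where "C = (1 - t * Q) * B * p * w / (d * e)"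
  have "(1 - t * Q) * t * p * ((1 - p) * B) * w / d +
      B * p * ((z - t) * w / d * (1 - t * Q) -
          (1 - t * Q) * (w * (z - t * p) / d) / e * (1 - z * t * Q)) =
      C * ((1 - p) * t * e + (z - t) * e - (z - t * p) * (1 - z * t * Q))"
    unfolding C_def using nz by (simp add: divide_simps) (simp add: algebra_simps)
  also have "\<dots> = (1 - t * Q) * t * (p * Q) * ((z - p) * B) * (w * (z - t * p) / d) / e"
    unfolding key C_def using nz by simp
  finally show ?thesis unfolding d_def e_def .
qed

lemma dixon_certificate:
  fixes z a b p Q x A B :: "'a :: field"
  assumes "1 - z * (p * Q) \<noteq> 0" "1 - z * (p * Q * Q) \<noteq> 0"
  shows "- ((1 - z * Q) * z * (p * Q) * x * (A * (1 - a * (p * Q))) * (B * (1 - b * (p * Q)))) /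
      (1 - z * (p * Q)) +
    p * Q * (1 + p * Q) * A * B *
      (x * (z - p) / (1 - z * (p * Q)) * ((1 - z * Q * a * b) * (1 - z * Q)) -
       x * p * (z * Q - 1) * (1 - z * Q) / ((1 - z * (p * Q)) * (1 - z * (p * Q * Q))) *
           ((1 - z * Q * a) * (1 - z * Q * b))) =
    - ((1 - z * Q) * z * (p * Q * Q) * (x * (z - p) / (1 - z * (p * Q))) * (A * (a - p * Q)) *
        (B * (b - p * Q))) / (1 - z * (p * Q * Q))"
proof -
  define d e where "d = 1 - z * (p * Q)" and "e = 1 - z * (p * Q * Q)"
  have nz: "d \<noteq> 0" "e \<noteq> 0" using assms by (simp_all add: d_def e_def)
  have "- (z * (1 - a * (p * Q)) * (1 - b * (p * Q)) * e) +
    (1 + p * Q) * ((z - p) * (1 - z * Q * a * b) * e -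
        p * (z * Q - 1) * ((1 - z * Q * a) * (1 - z * Q * b))) =
    - (z * Q * (z - p) * (a - p * Q) * (b - p * Q))"
    unfolding e_def by algebra
  hence "(1 - z * Q) * A * B * p * Q * x * (- (z * (1 - a * (p * Q)) * (1 - b * (p * Q)) * e) +
    (1 + p * Q) * ((z - p) * (1 - z * Q * a * b) * e -
        p * (z * Q - 1) * ((1 - z * Q * a) * (1 - z * Q * b)))) =
    (1 - z * Q) * A * B * p * Q * x * (- (z * Q * (z - p) * (a - p * Q) * (b - p * Q)))" by simp
  thus ?thesis
    unfolding d_def[symmetric] e_def[symmetric] using nz
    by (simp add: divide_simps) (simp add: algebra_simps)
qed

section \<open>Telescoping of the q-Gauss and q-Dixon sums\<close>

context q_base begin

text \<open>Telescoping requires the summands at t and at tq to be rational multiples of one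
  product. That common product is \<open>qquot z (t * Q) t n\<close>, here and in the next
  lemma.\<close>

lemma qquot_diag_Suc:
  "qquot z t t (Suc n) = (z - t) * qquot z (t * Q) t n / (1 - t * Q ^ Suc n)"
proof (induction n)
  case (Suc n)
  show ?case
    unfolding qquot_Suc[of z t t "Suc n"] Suc qquot_Suc[of z "t * Q" t n] by (simp add: mult_ac)
qed (simp add: qquot_Suc)

lemma qquot_diag_shift:
  assumes "norm t \<le> 1"
  shows "qquot z (t * Q) (t * Q) n = (1 - t * Q) * qquot z (t * Q) t n / (1 - t * Q ^ Suc n)"
proof (induction n)
  case 0
  show ?case using one_minus_Q_power_nonzero[OF assms, of 0] by simp
next
  case (Suc n)
  show ?case
    using one_minus_Q_power_nonzero[OF assms, of n]
    unfolding qquot_Suc Suc by (simp add: mult_ac)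
qed

text \<open>Since zq - q^(i+1) = q (z - q^i), the product at zq is the one at z moved by one place,
  up to a power of q and boundary factors. This makes the Dixon summands at z and zq
  comparable.\<close>

lemma qquot_shift_Suc:
  assumes "norm z \<le> 1"
  shows "qquot (z * Q) 1 (z * Q) (Suc n) =
    qquot z 1 z n * Q ^ n * (z * Q - 1) * (1 - z * Q) / ((1 - z * Q ^ Suc n) * (1 - z * Q ^ Suc (Suc n)))"
proof (induction n)
  case 0
  show ?case using one_minus_Q_power_nonzero[OF assms, of 0] by (simp add: qquot_Suc)
next
  case (Suc n)
  have *: "z * Q - Q ^ Suc n = Q * (z - Q ^ n)" by (simp add: algebra_simps)
  show ?case
    using one_minus_Q_power_nonzero[OF assms, of n] one_minus_Q_power_nonzero[OF assms, of "Suc n"]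
    unfolding qquot_Suc[of "z * Q" 1 "z * Q" "Suc n"] Suc qquot_Suc[of z 1 z n] mult_1 *
    by (simp add: mult_ac)
qed

text \<open>The closed form carries the factor q^(N+1), so it vanishes as N grows and the finite
  identity becomes a recursion between the Gauss sums at t and at tq.\<close>

lemma gauss_partial_sum:
  assumes "norm t \<le> 1"
  shows "(\<Sum>n\<le>N. qbin_coeff z n * Q ^ n *
      (qquot z t t n * (1 - t * Q) - qquot z (t * Q) (t * Q) n * (1 - z * t * Q))) =
    (1 - t * Q) * t * Q ^ Suc N * ((z - Q ^ N) * qbin_coeff z N) * qquot z (t * Q) t N /
        (1 - t * Q ^ Suc N)"
proof (induction N)
  case 0
  show ?case
    using one_minus_Q_power_nonzero[OF assms, of 0] by (simp add: qbin_coeff_def field_simps)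
next
  case (Suc N)
  have nz: "1 - t * Q ^ Suc N \<noteq> 0" "1 - t * (Q ^ Suc N * Q) \<noteq> 0"
    using one_minus_Q_power_nonzero[OF assms, of N] one_minus_Q_power_nonzero[OF assms, of "Suc N"]
    by (simp_all add: mult_ac)
  have p: "Q ^ Suc (Suc N) = Q ^ Suc N * Q" by simp
  have w: "qquot z (t * Q) t (Suc N) = qquot z (t * Q) t N * (z - t * Q ^ Suc N) / (1 - t * Q ^ Suc N)"
    by (simp add: qquot_Suc mult_ac)
  show ?case
    \<comment> \<open>Folding turns the old boundary term into a multiple of
      \<open>qbin_coeff z (Suc N)\<close>, the factor it shares with the new summand.\<close>
    unfolding sum.atMost_Suc Suc[folded qbin_coeff_Suc]
    unfolding qquot_diag_Suc[of z t] qquot_diag_shift[OF assms] p w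
    by (rule gauss_certificate[OF nz])
qed

lemma norm_mult_le: "norm x \<le> a \<Longrightarrow> norm y \<le> b \<Longrightarrow> norm (x * y :: complex) \<le> a * b"
  unfolding norm_mult by (intro mult_mono) (auto intro: order_trans[OF norm_ge_zero])

lemma tendsto_bounded_mult_Q_power:
  assumes "\<And>n. norm (f n) \<le> C"
  shows "(\<lambda>n. f n * Q ^ n) \<longlonglongrightarrow> 0"
proof (rule Lim_null_comparison)
  show "\<forall>\<^sub>F n in sequentially. norm (f n * Q ^ n) \<le> C * q ^ n"
    using assms q_pos by (intro always_eventually allI) (simp add: norm_mult norm_power mult_right_mono)
  show "(\<lambda>n. C * q ^ n) \<longlonglongrightarrow> 0"
    using q_less_1 by (intro tendsto_mult_right_zero LIMSEQ_power_zero) simp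
qed

lemma summable_bounded_mult_q_power: "summable (\<lambda>n. C * q ^ n)"
  using q_less_1 by (intro summable_mult summable_geometric) simp

lemma inverse_bounded:
  assumes "norm s \<le> 1"
  shows "norm (inverse (1 - s * Q ^ Suc n)) \<le> 1 / (1 - q)"
proof -
  have "norm (s * Q ^ Suc n) \<le> q ^ Suc n"
    unfolding norm_mult norm_Q_power using assms q_pos mult_left_le_one_le[of "q ^ Suc n" "norm s"]
        by simp
  also have "\<dots> \<le> q" using q_pos mult_left_le[OF q_power_le_1[of n], of q] by simp
  finally have "1 - q \<le> norm (1 - s * Q ^ Suc n)"
    using norm_triangle_ineq2[of 1 "s * Q ^ Suc n"] by simp
  thus ?thesis using q_less_1 le_imp_inverse_le[of "1 - q"]
      by (simp add: norm_inverse norm_divide inverse_eq_divide)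
qed

text \<open>For nonzero z and t this is the q-Gauss sum 2phi1(1/z, t/z; tq; q, z^2 q). The recursion
  in t ends at t = 0, where the quotient has become z^n and a q-binomial series at zq
  remains.\<close>

lemma q_gauss:
  assumes z: "norm z < 1" and t: "norm t \<le> 1"
  shows "summable (\<lambda>n. norm (qbin_coeff z n * Q ^ n * qquot z t t n))" (is ?sum)
    and "(\<Sum>n. qbin_coeff z n * Q ^ n * qquot z t t n) * qp (t * Q) * qp (z\<^sup>2 * Q) =
        qp (z * t * Q) * qp (z * Q)"
proof -
  obtain K where K: "\<And>z t s n. norm z \<le> 1 \<Longrightarrow> norm t \<le> 1 \<Longrightarrow> norm s \<le> 1 \<Longrightarrow> norm (qquot z t s n) \<le> K"
    and "K > 0" using qquot_bounded by blast
  have z': "norm z \<le> 1" using z by simp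
  have bound: "norm (qbin_coeff z n * Q ^ n * qquot z s s n) \<le> K * K * q ^ n" if "norm s \<le> 1" for s n
  proof -
    have "norm (qbin_coeff z n * Q ^ n * qquot z s s n) =
        (norm (qbin_coeff z n) * norm (qquot z s s n)) * q ^ n"
      by (simp add: norm_mult norm_power)
    also have "\<dots> \<le> (K * K) * q ^ n"
      unfolding qbin_coeff_def using that z' q_pos \<open>K > 0\<close>
      by (intro mult_right_mono mult_mono K) simp_all
    finally show ?thesis .
  qed
  have summ: "summable (\<lambda>n. norm (qbin_coeff z n * Q ^ n * qquot z s s n))" if "norm s \<le> 1" for s
    by (rule summable_comparison_test'[OF summable_bounded_mult_q_power[of "K * K"]])
        (use bound[OF that] in simp)
  show ?sum using summ[OF t] .
  define D where "D s = (\<Sum>n. qbin_coeff z n * Q ^ n * qquot z s s n)" for s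
  have sums: "(\<lambda>n. qbin_coeff z n * Q ^ n * qquot z s s n) sums D s" if "norm s \<le> 1" for s
    unfolding D_def using summable_norm_cancel[OF summ[OF that]] summable_sums by blast
  have rec: "D s * (1 - s * Q) = (1 - z * s * Q) * D (s * Q)" if s: "norm s \<le> 1" for s
  proof -
    have s': "norm (s * Q) \<le> 1" using norm_mult_Q_power_le_1[OF s, of 1] by simp
    have "(\<lambda>n. qbin_coeff z n * Q ^ n * qquot z s s n * (1 - s * Q) -
       qbin_coeff z n * Q ^ n * qquot z (s * Q) (s * Q) n * (1 - z * s * Q)) sums
       (D s * (1 - s * Q) - D (s * Q) * (1 - z * s * Q))"
      by (intro sums_diff sums_mult2 sums s s')
    hence "(\<lambda>N. \<Sum>n\<le>N. qbin_coeff z n * Q ^ n *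
      (qquot z s s n * (1 - s * Q) - qquot z (s * Q) (s * Q) n * (1 - z * s * Q))) \<longlonglongrightarrow>
       D s * (1 - s * Q) - D (s * Q) * (1 - z * s * Q)"
      unfolding sums_def_le by (simp add: algebra_simps)
    \<comment> \<open>Apart from one explicit power q^N, all factors of the boundary term are
      bounded uniformly in N.\<close>
    moreover have "(\<lambda>N. (1 - s * Q) * s * Q ^ Suc N * ((z - Q ^ N) * qbin_coeff z N) *
        qquot z (s * Q) s N / (1 - s * Q ^ Suc N)) \<longlonglongrightarrow> 0"
    proof -
      have "(\<lambda>N. (1 - s * Q) * s * Q * ((z - Q ^ N) * qbin_coeff z N) * qquot z (s * Q) s N *
        inverse (1 - s * Q ^ Suc N) * Q ^ N) \<longlonglongrightarrow> 0"
      proof (rule tendsto_bounded_mult_Q_power)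
        fix N
        have "norm (z - Q ^ N) \<le> 2"
          using norm_triangle_ineq4[of z "Q ^ N"] z' q_power_le_1[of N] by simp
        thus "norm ((1 - s * Q) * s * Q * ((z - Q ^ N) * qbin_coeff z N) * qquot z (s * Q) s N *
            inverse (1 - s * Q ^ Suc N))
         \<le> norm ((1 - s * Q) * s * Q) * (2 * K) * K * (1 / (1 - q))"
          unfolding qbin_coeff_def by (intro norm_mult_le K inverse_bounded) (use s s' z' in auto)
      qed
      thus ?thesis by (simp add: divide_inverse mult_ac)
    qed
    ultimately have "D s * (1 - s * Q) - D (s * Q) * (1 - z * s * Q) = 0"
      unfolding gauss_partial_sum[OF s] by (rule LIMSEQ_unique)
    thus ?thesis by (simp add: algebra_simps)
  qed
  have "D (t * Q ^ 0) * qp (t * Q) = qp (z * t * Q) * (\<Sum>n. qbin_coeff z n * Q ^ n * z ^ n)"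
  proof (rule prod_recursion_limit[where h = "\<lambda>n. D (t * Q ^ n)"])
    show "D (t * Q ^ n) * (1 - t * Q * Q ^ n) = (1 - z * t * Q * Q ^ n) * D (t * Q ^ Suc n)" for n
      using rec[of "t * Q ^ n"] norm_mult_Q_power_le_1[OF t, of n] by (simp add: mult_ac)
    show "(\<lambda>n. D (t * Q ^ n)) \<longlonglongrightarrow> (\<Sum>n. qbin_coeff z n * Q ^ n * z ^ n)"
      unfolding D_def
      by (rule tendsto_suminf_dominated[OF _ bound summable_bounded_mult_q_power])
         (intro tendsto_mult tendsto_const qquot_tendsto norm_mult_Q_power_le_1[OF t])+
  qed (rule qp_tendsto)+
  moreover have "(\<Sum>n. qbin_coeff z n * Q ^ n * z ^ n) * qp (z\<^sup>2 * Q) = qp (z * Q)"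
    using q_binomial[of z "z * Q"] z norm_mult_Q_power_le_1[of z 1]
    by (simp add: power2_eq_square power_mult_distrib mult_ac)
  ultimately show "(\<Sum>n. qbin_coeff z n * Q ^ n * qquot z t t n) * qp (t * Q) * qp (z\<^sup>2 * Q) =
      qp (z * t * Q) * qp (z * Q)"
    by (simp add: D_def mult.assoc)
qed

text \<open>For z \<noteq> 0 this is z^k (1/z;q)_k / (zq;q)_k, which will be the ratio c_k(z) /
  c_0(z) of Laurent coefficients for k >= 0.\<close>

definition qterm :: "complex \<Rightarrow> nat \<Rightarrow> complex" where
  "qterm z = qquot z 1 z"

lemma qterm_Suc: "qterm z (Suc n) = qterm z n * (z - Q ^ n) / (1 - z * Q ^ Suc n)"
  by (simp add: qterm_def qquot_Suc)

text \<open>The difference in front of the sum is the contribution of k = 0: that term is 1 in both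
  Dixon sums and lacks the factor q^k (1 + q^k), so it stands apart. The closed form again tends to
  0 through its power of q.\<close>

lemma dixon_partial_sum:
  assumes "norm z \<le> 1" "norm a \<le> 1" "norm b \<le> 1"
  shows "(1 - z * Q * a * b) * (1 - z * Q) - (1 - z * Q * a) * (1 - z * Q * b) +
    (\<Sum>k<n. Q ^ Suc k * (1 + Q ^ Suc k) * qterm a (Suc k) * qterm b (Suc k) *
      (qterm z (Suc k) * ((1 - z * Q * a * b) * (1 - z * Q)) -
       qterm (z * Q) (Suc k) * ((1 - z * Q * a) * (1 - z * Q * b)))) =
    - ((1 - z * Q) * z * Q ^ Suc n * qterm z n * (qterm a n * (a - Q ^ n)) *
        (qterm b n * (b - Q ^ n))) / (1 - z * Q ^ Suc n)"
proof (induction n)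
  case 0
  show ?case
    using one_minus_Q_power_nonzero[OF assms(1), of 0] by (simp add: qterm_def) algebra
next
  case (Suc n)
  have nz: "1 - z * (Q ^ n * Q) \<noteq> 0" "1 - z * (Q ^ n * Q * Q) \<noteq> 0" "1 - a * (Q ^ n * Q) \<noteq> 0"
      "1 - b * (Q ^ n * Q) \<noteq> 0"
    using one_minus_Q_power_nonzero[OF assms(1), of n] one_minus_Q_power_nonzero[OF assms(1), of "Suc n"]
      one_minus_Q_power_nonzero[OF assms(2), of n] one_minus_Q_power_nonzero[OF assms(3), of n]
    by (simp_all add: mult_ac)
  have p: "Q ^ Suc n = Q ^ n * Q" "Q ^ Suc (Suc n) = Q ^ n * Q * Q" by simp_all
  \<comment> \<open>Raising the index in the boundary term makes \<open>qterm a (Suc n)\<close> and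
    \<open>qterm b (Suc n)\<close> common to all terms of the induction step.\<close>
  have ab: "qterm a n * (a - Q ^ n) = qterm a (Suc n) * (1 - a * (Q ^ n * Q))"
    "qterm b n * (b - Q ^ n) = qterm b (Suc n) * (1 - b * (Q ^ n * Q))"
    using nz unfolding qterm_Suc p by simp_all
  have z1: "qterm z (Suc n) = qterm z n * (z - Q ^ n) / (1 - z * (Q ^ n * Q))"
    unfolding qterm_Suc p ..
  have z2: "qterm (z * Q) (Suc n) = qterm z n * Q ^ n * (z * Q - 1) * (1 - z * Q) /
      ((1 - z * (Q ^ n * Q)) * (1 - z * (Q ^ n * Q * Q)))"
    using qquot_shift_Suc[OF assms(1), of n] unfolding qterm_def p .
  show ?case
    unfolding sum.lessThan_Suc add.assoc[symmetric] Suc ab p z1 z2 by (rule dixon_certificate[OF nz(1,2)])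
qed

text \<open>This is a bilateral sum folded at k and -k: with c_{-k} = q^k c_k the two terms carry
  q^k and q^(2k), whence the factor q^k (1 + q^k), while k = 0 occurs once and gives the leading
  1.\<close>

lemma q_dixon:
  assumes z: "norm z \<le> 1" and a: "norm a < 1" and b: "norm b < 1"
  shows "summable (\<lambda>k. norm (Q ^ Suc k * (1 + Q ^ Suc k) * qterm a (Suc k) * qterm b (Suc k) *
      qterm z (Suc k)))" (is ?sum)
    and "(1 + (\<Sum>k. Q ^ Suc k * (1 + Q ^ Suc k) * qterm a (Suc k) * qterm b (Suc k) * qterm z (Suc k))) *
      (qp (z * a * b * Q) * qp (z * Q) * qp (a * Q) * qp (b * Q)) =
      qp Q * qp (z * a * Q) * qp (z * b * Q) * qp (a * b * Q)"
proof -
  obtain K where K: "\<And>z t s n. norm z \<le> 1 \<Longrightarrow> norm t \<le> 1 \<Longrightarrow> norm s \<le> 1 \<Longrightarrow> norm (qquot z t s n) \<le> K"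
    and "K > 0" using qquot_bounded by blast
  have Kt: "norm (qterm x n) \<le> K" if "norm x \<le> 1" for x n
    unfolding qterm_def using that by (intro K) auto
  have ab: "norm a \<le> 1" "norm b \<le> 1" using a b by simp_all
  define f where "f s k = Q ^ Suc k * (1 + Q ^ Suc k) * qterm a (Suc k) * qterm b (Suc k) *
      qterm s (Suc k)" for s k
  have bound: "norm (f s k) \<le> (2 * K * K * K) * q ^ k" if "norm s \<le> 1" for s k
  proof -
    have "norm (1 + Q ^ Suc k) \<le> norm (1::complex) + norm (Q ^ Suc k)" by (rule norm_triangle_ineq)
    also have "\<dots> \<le> 2" using q_power_le_1[of "Suc k"] unfolding norm_Q_power by simp
    finally have 2: "norm (1 + Q ^ Suc k) \<le> 2" .
    have "norm (f s k) = norm (1 + Q ^ Suc k) * norm (qterm a (Suc k)) * norm (qterm b (Suc k)) *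
        norm (qterm s (Suc k)) * q ^ Suc k"
      unfolding f_def norm_mult norm_Q_power by (simp only: mult_ac)
    also have "\<dots> \<le> (2 * K * K * K) * q ^ k"
      using 2 \<open>K > 0\<close> q_pos q_less_1 that ab
          by (intro mult_mono Kt) (auto intro: power_decreasing mult_left_le_one_le)
    finally show ?thesis .
  qed
  have summ: "summable (\<lambda>k. norm (f s k))" if "norm s \<le> 1" for s
    by (rule summable_comparison_test'[OF summable_bounded_mult_q_power[of "2 * K * K * K"]])
        (use bound[OF that] in simp)
  show ?sum using summ[OF z] by (simp only: f_def)
  define S where "S s = 1 + (\<Sum>k. f s k)" for s
  have sums: "f s sums (S s - 1)" if "norm s \<le> 1" for s
    unfolding S_def using summable_norm_cancel[OF summ[OF that]] summable_sums by auto
  have rec: "S s * ((1 - s * Q * a * b) * (1 - s * Q)) = ((1 - s * Q * a) * (1 - s * Q * b)) * S (s * Q)"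
    if s: "norm s \<le> 1" for s
  proof -
    define c d where "c = (1 - s * Q * a * b) * (1 - s * Q)" and "d = (1 - s * Q * a) * (1 - s * Q * b)"
    have s': "norm (s * Q) \<le> 1" using norm_mult_Q_power_le_1[OF s, of 1] by simp
    have "(\<lambda>k. f s k * c - f (s * Q) k * d) sums ((S s - 1) * c - (S (s * Q) - 1) * d)"
      by (intro sums_diff sums_mult2 sums s s')
    hence "(\<lambda>n. c - d + (\<Sum>k<n. f s k * c - f (s * Q) k * d)) \<longlonglongrightarrow>
        c - d + ((S s - 1) * c - (S (s * Q) - 1) * d)"
      unfolding sums_def by (intro tendsto_add tendsto_const)
    moreover have "c - d + (\<Sum>k<n. f s k * c - f (s * Q) k * d) =
      - ((1 - s * Q) * s * Q ^ Suc n * qterm s n * (qterm a n * (a - Q ^ n)) *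
          (qterm b n * (b - Q ^ n))) / (1 - s * Q ^ Suc n)" for n
      unfolding dixon_partial_sum[OF s ab, symmetric] c_def[symmetric] d_def[symmetric] f_def
      by (simp add: algebra_simps)
    moreover have "(\<lambda>n. - ((1 - s * Q) * s * Q ^ Suc n * qterm s n * (qterm a n * (a - Q ^ n)) *
        (qterm b n * (b - Q ^ n))) / (1 - s * Q ^ Suc n)) \<longlonglongrightarrow> 0"
    proof -
      have "(\<lambda>n. - ((1 - s * Q) * s * Q) * qterm s n * (qterm a n * (a - Q ^ n)) *
          (qterm b n * (b - Q ^ n)) *
        inverse (1 - s * Q ^ Suc n) * Q ^ n) \<longlonglongrightarrow> 0"
      proof (rule tendsto_bounded_mult_Q_power)
        fix n
        have 2: "norm (x - Q ^ n) \<le> 2" if "norm x \<le> 1" for x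
          using norm_triangle_ineq4[of x "Q ^ n"] that q_power_le_1[of n] by simp
        show "norm (- ((1 - s * Q) * s * Q) * qterm s n * (qterm a n * (a - Q ^ n)) *
            (qterm b n * (b - Q ^ n)) *
            inverse (1 - s * Q ^ Suc n))
          \<le> norm (- ((1 - s * Q) * s * Q)) * K * (K * 2) * (K * 2) * (1 / (1 - q))"
          by (intro norm_mult_le Kt 2 inverse_bounded) (use s ab in auto)
      qed
      thus ?thesis by (simp add: divide_inverse mult_ac)
    qed
    ultimately have "c - d + ((S s - 1) * c - (S (s * Q) - 1) * d) = 0"
      using LIMSEQ_unique by simp
    hence "S s * c = d * S (s * Q)" by (simp add: algebra_simps)
    thus ?thesis unfolding c_def d_def .
  qed
  \<comment> \<open>The termwise limit of the sum as its parameter tends to 0. It does not involve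
    the starting point, so \<open>main\<close> may be used at z and at 1 with the same
    \<open>L\<close>.\<close>
  define L where "L = 1 + (\<Sum>k. Q ^ Suc k * (1 + Q ^ Suc k) * qterm a (Suc k) * qterm b (Suc k) *
      qquot 0 1 0 (Suc k))"
  have main: "S s * (qp (s * a * b * Q) * qp (s * Q)) = qp (s * a * Q) * qp (s * b * Q) * L"
      if s: "norm s \<le> 1" for s
  proof -
    have "S (s * Q ^ 0) * (qp (s * a * b * Q) * qp (s * Q)) = qp (s * a * Q) * qp (s * b * Q) * L"
    proof (rule prod_recursion_limit[where h = "\<lambda>n. S (s * Q ^ n)"])
      show "S (s * Q ^ n) * ((1 - s * a * b * Q * Q ^ n) * (1 - s * Q * Q ^ n)) =
        ((1 - s * a * Q * Q ^ n) * (1 - s * b * Q * Q ^ n)) * S (s * Q ^ Suc n)" for n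
        using rec[of "s * Q ^ n"] norm_mult_Q_power_le_1[OF s, of n] by (simp add: mult_ac)
      show "(\<lambda>n. S (s * Q ^ n)) \<longlonglongrightarrow> L"
        unfolding S_def L_def
        by (intro tendsto_add tendsto_const
            tendsto_suminf_dominated[OF _ bound summable_bounded_mult_q_power],
            unfold f_def qterm_def)
           (intro tendsto_mult tendsto_const qquot_tendsto norm_mult_Q_power_le_1[OF s])+
    qed (unfold prod.distrib, (intro tendsto_mult qp_tendsto)+)
    thus ?thesis by simp
  qed
  \<comment> \<open>The factor with i = 0 in the numerator is 1 - q^0.\<close>
  have "qterm 1 (Suc k) = 0" for k
    unfolding qterm_def qquot_def by (rule prod_zero) (auto intro!: bexI[of _ 0])
  hence "f 1 k = 0" for k by (simp add: f_def)
  hence "S 1 = 1" by (simp add: S_def)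
  hence L: "qp (a * b * Q) * qp Q = qp (a * Q) * qp (b * Q) * L" using main[of 1] by simp
  have "S z * (qp (z * a * b * Q) * qp (z * Q) * qp (a * Q) * qp (b * Q)) =
     (S z * (qp (z * a * b * Q) * qp (z * Q))) * (qp (a * Q) * qp (b * Q))" by simp
  also have "\<dots> = qp (z * a * Q) * qp (z * b * Q) * (qp (a * Q) * qp (b * Q) * L)"
    unfolding main[OF z] by simp
  also have "\<dots> = qp Q * qp (z * a * Q) * qp (z * b * Q) * qp (a * b * Q)"
    unfolding L[symmetric] by simp
  finally show "(1 + (\<Sum>k. Q ^ Suc k * (1 + Q ^ Suc k) * qterm a (Suc k) * qterm b (Suc k) *
      qterm z (Suc k))) *
      (qp (z * a * b * Q) * qp (z * Q) * qp (a * Q) * qp (b * Q)) =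
      qp Q * qp (z * a * Q) * qp (z * b * Q) * qp (a * b * Q)"
    by (simp only: S_def f_def)
qed

end

section \<open>Laurent expansion of the kernel\<close>

lemma has_sum_product:
  fixes f :: "'a \<Rightarrow> 'c :: {banach, real_normed_div_algebra}" and g :: "'b \<Rightarrow> 'c"
  assumes f: "(\<lambda>x. norm (f x)) summable_on A" "(f has_sum a) A"
      and g: "(\<lambda>x. norm (g x)) summable_on B" "(g has_sum b) B"
  shows "(\<lambda>p. norm (case p of (x, y) \<Rightarrow> f x * g y)) summable_on A \<times> B"
    and "((\<lambda>(x, y). f x * g y) has_sum a * b) (A \<times> B)"
proof -
  show *: "(\<lambda>p. norm (case p of (x, y) \<Rightarrow> f x * g y)) summable_on A \<times> B"
  proof (rule summable_on_SigmaI)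
    show "((\<lambda>y. norm (case (x, y) of (x, y) \<Rightarrow> f x * g y)) has_sum
        norm (f x) * infsum (\<lambda>y. norm (g y)) B) B" for x
      using g(1) by (auto simp: norm_mult intro!: has_sum_cmult_right has_sum_infsum)
    show "(\<lambda>x. norm (f x) * infsum (\<lambda>y. norm (g y)) B) summable_on A"
      using f(1) by (rule summable_on_cmult_left)
  qed simp
  show "((\<lambda>(x, y). f x * g y) has_sum a * b) (A \<times> B)"
  proof (rule has_sum_SigmaI)
    show "((\<lambda>y. case (x, y) of (x, y) \<Rightarrow> f x * g y) has_sum f x * b) B" for x
      using g(2) by (auto intro: has_sum_cmult_right)
    show "((\<lambda>x. f x * b) has_sum a * b) A" using f(2) by (rule has_sum_cmult_left)
    show "(\<lambda>(x, y). f x * g y) summable_on A \<times> B" using * by (rule abs_summable_summable)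
  qed
qed

context q_base begin

text \<open>The value of the q-Gauss sum at t = 1, that is, the constant term c_0(z).\<close>

definition const_coeff :: "complex \<Rightarrow> complex" where
  "const_coeff z = (qp (z * Q))\<^sup>2 / (qp Q * qp (z\<^sup>2 * Q))"

text \<open>The power of q at negative indices reflects the invariance of f_z under x -> q/x, which
  forces c_{-k} = q^k c_k.\<close>

definition laurent_coeff :: "complex \<Rightarrow> int \<Rightarrow> complex" where
  "laurent_coeff z k =
     const_coeff z * (if k \<ge> 0 then qterm z (nat k) else Q ^ nat (- k) * qterm z (nat (- k)))"

lemma norm_square_less_1: "norm z < 1 \<Longrightarrow> norm (z\<^sup>2 :: complex) < 1"
  by (simp add: norm_power power_less_one_iff abs_square_less_1)

lemma qbin_coeff_add: "qbin_coeff z (k + n) = qbin_coeff z k * qquot z (Q ^ k) (Q ^ k) n"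
proof (induction n)
  case (Suc n)
  show ?case
    unfolding add_Suc_right qquot_Suc qbin_coeff_def
    unfolding qbin_coeff_def[symmetric] Suc by (simp add: power_add mult_ac)
qed simp

text \<open>Both quotients have the same numerators; only the denominators (q;q)_k and (zq;q)_k
  differ, and these are ratios of infinite products.\<close>

lemma qterm_eq_qbin_coeff:
  assumes "norm z \<le> 1"
  shows "qbin_coeff z k * (qp (z * Q * Q ^ k) * qp Q) = qterm z k * (qp (z * Q) * qp (Q * Q ^ k))"
proof -
  have "qbin_coeff z k * (\<Prod>i<k. 1 - Q * Q ^ i) = qterm z k * (\<Prod>i<k. 1 - z * Q * Q ^ i)"
    using one_minus_Q_power_nonzero[of 1] one_minus_Q_power_nonzero[OF assms]
    unfolding qbin_coeff_def qterm_def qquot_def prod.distrib[symmetric]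
    by (intro prod.cong refl) (simp add: mult_ac)
  thus ?thesis
    unfolding qp_split[of Q k] qp_split[of "z * Q" k] by (simp add: mult_ac)
qed

text \<open>In the product of the q-binomial series in x and in q/x, the power x^k pairs index k + n
  with index n. Taking out \<open>qbin_coeff z k\<close> leaves the q-Gauss sum with t =
  q^k.\<close>

lemma gauss_coeff:
  assumes z: "norm z < 1"
  shows "((\<lambda>n. qbin_coeff z (k + n) * (qbin_coeff z n * Q ^ n)) has_sum const_coeff z * qterm z k) UNIV"
proof -
  define f where "f n = qbin_coeff z n * Q ^ n * qquot z (Q ^ k) (Q ^ k) n" for n
  have eq: "qbin_coeff z (k + n) * (qbin_coeff z n * Q ^ n) = qbin_coeff z k * f n" for n
    by (simp add: qbin_coeff_add f_def)
  have t: "norm (Q ^ k) \<le> 1" using q_power_le_1 by simp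
  have nz: "qp (Q ^ k * Q) \<noteq> 0" "qp (z\<^sup>2 * Q) \<noteq> 0" "qp Q \<noteq> 0"
    using qp_Q_nonzero[OF t] qp_Q_nonzero[of "z\<^sup>2"] qp_Q_nonzero[of 1] norm_square_less_1[OF z]
        by simp_all
  have S: "(\<Sum>n. f n) = qp (z * Q ^ k * Q) * qp (z * Q) / (qp (Q ^ k * Q) * qp (z\<^sup>2 * Q))"
    using q_gauss(2)[OF z t] nz by (simp add: f_def field_simps)
  have summ: "summable (\<lambda>n. norm (f n))" unfolding f_def by (rule q_gauss(1)[OF z t])
  have "(f has_sum (\<Sum>n. f n)) UNIV"
    by (rule norm_summable_imp_has_sum[OF summ summable_sums[OF summable_norm_cancel[OF summ]]])
  hence "((\<lambda>n. qbin_coeff z k * f n) has_sum qbin_coeff z k * (\<Sum>n. f n)) UNIV"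
    by (rule has_sum_cmult_right)
  moreover have "qbin_coeff z k * (\<Sum>n. f n) = const_coeff z * qterm z k"
    using qterm_eq_qbin_coeff[of z k] z nz unfolding S const_coeff_def
    by (simp add: divide_simps power2_eq_square mult_ac)
  ultimately show "((\<lambda>n. qbin_coeff z (k + n) * (qbin_coeff z n * Q ^ n)) has_sum
      const_coeff z * qterm z k) UNIV"
    unfolding eq by simp
qed

text \<open>The product of the two q-binomial series is absolutely summable over all pairs (m, n),
  so it may be regrouped along k = m - n; the inner sums are those of
  \<open>gauss_coeff\<close>.\<close>

lemma laurent_expansion:
  assumes z: "norm z < 1" and x: "norm x = 1"
  shows "(\<lambda>k. norm (laurent_coeff z k * x powi k)) summable_on UNIV"
    and "((\<lambda>k. laurent_coeff z k * x powi k) has_sum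
        qp x * qp (Q / x) / (qp (z * x) * qp (z * (Q / x)))) UNIV"
proof -
  have x0: "x \<noteq> 0" using x by auto
  have y: "norm (Q / x) \<le> 1" using x q_less_1 by (simp add: norm_divide)
  have A: "(\<lambda>n. norm (qbin_coeff z n * u ^ n)) summable_on UNIV"
    "((\<lambda>n. qbin_coeff z n * u ^ n) has_sum qp u / qp (z * u)) UNIV" if u: "norm u \<le> 1" for u
  proof -
    have summ: "summable (\<lambda>n. norm (qbin_coeff z n * u ^ n))" by (rule summable_qbin[OF z u])
    show "(\<lambda>n. norm (qbin_coeff z n * u ^ n)) summable_on UNIV"
      using summ by (intro norm_summable_imp_summable_on) simp
    have "norm (z * u) < 1"
      using z u mult_left_le[of "norm u" "norm z"] by (simp add: norm_mult)
    hence "(\<Sum>n. qbin_coeff z n * u ^ n) = qp u / qp (z * u)"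
      using q_binomial[OF z u] qp_nonzero by (simp add: field_simps)
    thus "((\<lambda>n. qbin_coeff z n * u ^ n) has_sum qp u / qp (z * u)) UNIV"
      using norm_summable_imp_has_sum[OF summ summable_sums[OF summable_norm_cancel[OF summ]]] by simp
  qed
  define f where "f = (\<lambda>(m, n). qbin_coeff z m * x ^ m * (qbin_coeff z n * (Q / x) ^ n))"
  \<comment> \<open>\<open>g\<close> is \<open>f\<close> in the coordinates (k, n) = (m - n, n), and
    \<open>N k\<close> below collects the n for which m = k + n is not negative.\<close>
  define g where "g = (\<lambda>(k :: int, n). qbin_coeff z (nat (k + int n)) * (qbin_coeff z n * Q ^ n) *
      x powi k)"
  define N where "N k = {n. k + int n \<ge> 0}" for k
  have f: "(\<lambda>p. norm (f p)) summable_on UNIV"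
      "(f has_sum qp x * qp (Q / x) / (qp (z * x) * qp (z * (Q / x)))) UNIV"
    using has_sum_product[OF A A, OF _ _ y y, of x] x by (simp_all add: f_def)
  have fg: "g (int m - int n, n) = f (m, n)" for m n
    using x0 by (simp add: f_def g_def power_int_diff power_divide)
  have bij: "bij_betw (\<lambda>(m, n). (int m - int n, n)) UNIV (Sigma UNIV N)"
    by (rule bij_betwI[of _ _ _ "\<lambda>(k, n). (nat (k + int n), n)"]) (auto simp: N_def)
  have g: "(\<lambda>p. norm (g p)) summable_on Sigma UNIV N"
    "(g has_sum qp x * qp (Q / x) / (qp (z * x) * qp (z * (Q / x)))) (Sigma UNIV N)"
    using summable_on_reindex_bij_betw[OF bij, of "\<lambda>p. norm (g p)"]
        has_sum_reindex_bij_betw[OF bij, of g] f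
    by (simp_all add: case_prod_unfold fg)
  have inner: "((\<lambda>n. g (k, n)) has_sum laurent_coeff z k * x powi k) (N k)" for k
  proof (cases "k \<ge> 0")
    case True
    hence "N k = UNIV" by (auto simp: N_def)
    thus ?thesis
      using has_sum_cmult_left[OF gauss_coeff[OF z, of "nat k"], of "x powi k"] True
      by (simp add: g_def laurent_coeff_def nat_add_distrib)
  next
    case False
    define j where "j = nat (- k)"
    have k: "k = - int j" using False by (simp add: j_def)
    \<comment> \<open>For k = -j the admissible n start at j. Shifting by j exchanges the roles of
      the two coefficients and leaves the extra factor q^j.\<close>
    have bij: "bij_betw (\<lambda>n. j + n) UNIV (N k)"
      by (rule bij_betwI[of _ _ _ "\<lambda>n. n - j"]) (auto simp: N_def k)
    have "((\<lambda>n. g (k, j + n)) has_sum laurent_coeff z k * x powi k) UNIV"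
      using has_sum_cmult_left[OF has_sum_cmult_left[OF gauss_coeff[OF z, of j]], of "Q ^ j"
          "x powi k"] False
      by (simp add: g_def laurent_coeff_def k power_add mult_ac)
    thus ?thesis by (subst (asm) has_sum_reindex_bij_betw[OF bij])
  qed
  show "((\<lambda>k. laurent_coeff z k * x powi k) has_sum
      qp x * qp (Q / x) / (qp (z * x) * qp (z * (Q / x)))) UNIV"
    by (rule has_sum_SigmaD[OF g(2) inner])
  \<comment> \<open>The norm of a regrouped coefficient is at most the sum of norms over its fibre,
    and the fibre sums are summable because the whole family is.\<close>
  have "(\<lambda>k. infsum (\<lambda>n. norm (g (k, n))) (N k)) summable_on UNIV"
    using summable_on_Sigma_banach[of "\<lambda>k n. norm (g (k, n))" UNIV N] g(1) by (simp add: case_prod_unfold)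
  thus "(\<lambda>k. norm (laurent_coeff z k * x powi k)) summable_on UNIV"
  proof (rule Infinite_Sum.abs_summable_on_comparison_test')
    fix k
    have "(\<lambda>n. norm (g (k, n))) summable_on N k"
      using g(1) by (simp add: Infinite_Sum.abs_summable_on_Sigma_iff)
    thus "norm (laurent_coeff z k * x powi k) \<le> infsum (\<lambda>n. norm (g (k, n))) (N k)"
      by (rule norm_has_sum_bound[OF has_sum_infsum inner])
  qed
qed

lemma laurent_coeff_abs_summable:
  assumes "norm z < 1"
  shows "(\<lambda>k. norm (laurent_coeff z k)) summable_on UNIV"
  using laurent_expansion(1)[OF assms, of 1] by simp

section \<open>Symmetric partial sums of the Laurent series\<close>

definition laurent_sum :: "complex \<Rightarrow> nat \<Rightarrow> complex \<Rightarrow> complex" where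
  "laurent_sum z n x = (\<Sum>k\<in>{- int n..int n}. laurent_coeff z k * x powi k)"

lemma filterlim_symmetric_intervals:
  "filterlim (\<lambda>n. {- int n..int n}) (finite_subsets_at_top UNIV) sequentially"
  unfolding filterlim_finite_subsets_at_top
proof (intro allI impI)
  fix X :: "int set" assume "finite X \<and> X \<subseteq> UNIV"
  hence fin: "finite (abs ` X)" by simp
  define M where "M = Max (abs ` X)"
  have M: "\<bar>k\<bar> \<le> M" if "k \<in> X" for k
    unfolding M_def using fin that by (intro Max_ge) auto
  show "\<forall>\<^sub>F n in sequentially. finite {- int n..int n} \<and> X \<subseteq> {- int n..int n} \<and> {- int n..int n} \<subseteq> UNIV"
    using eventually_ge_at_top[of "nat M"]
  proof eventually_elim
    case (elim n)
    hence "k \<in> {- int n..int n}" if "k \<in> X" for k using M[OF that] by auto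
    thus ?case by auto
  qed
qed

lemma laurent_sum_tendsto:
  assumes "norm z < 1" "norm x = 1"
  shows "(\<lambda>n. laurent_sum z n x) \<longlonglongrightarrow> qp x * qp (Q / x) / (qp (z * x) * qp (z * (Q / x)))"
  unfolding laurent_sum_def
  using filterlim_compose[OF laurent_expansion(2)[OF assms, unfolded has_sum_def]
      filterlim_symmetric_intervals] .

lemma laurent_sum_bounded:
  assumes "norm z < 1" "norm x = 1"
  shows "norm (laurent_sum z n x) \<le> infsum (\<lambda>k. norm (laurent_coeff z k)) UNIV"
proof -
  have "norm (laurent_sum z n x) \<le> (\<Sum>k\<in>{- int n..int n}. norm (laurent_coeff z k))"
    unfolding laurent_sum_def
    by (rule order_trans[OF norm_sum]) (simp add: norm_mult norm_power_int assms(2))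
  also have "\<dots> \<le> infsum (\<lambda>k. norm (laurent_coeff z k)) UNIV"
    by (rule finite_sum_le_infsum) (use laurent_coeff_abs_summable[OF assms(1)] in auto)
  finally show ?thesis .
qed

text \<open>On a symmetric range the terms k and -k can be added in pairs: for k > 0 the first
  contributes q^k and the second q^(2k) times the same product of three \<open>qterm\<close> values,
  which is the folded form of the Dixon sum.\<close>

lemma laurent_coeff_sum_tendsto:
  assumes "norm a < 1" "norm b < 1" "norm c < 1"
  shows "(\<lambda>n. \<Sum>k\<in>{- int n..int n}. laurent_coeff a k * laurent_coeff b k * laurent_coeff c (- k)) \<longlonglongrightarrow>
    const_coeff a * const_coeff b * const_coeff c *
      (1 + (\<Sum>k. Q ^ Suc k * (1 + Q ^ Suc k) * qterm b (Suc k) * qterm c (Suc k) * qterm a (Suc k)))"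
proof -
  let ?C = "const_coeff a * const_coeff b * const_coeff c"
  let ?f = "\<lambda>k. Q ^ Suc k * (1 + Q ^ Suc k) * qterm b (Suc k) * qterm c (Suc k) * qterm a (Suc k)"
  let ?g = "\<lambda>k. laurent_coeff a k * laurent_coeff b k * laurent_coeff c (- k)"
  have eq: "(\<Sum>k\<in>{- int n..int n}. ?g k) = ?C * (1 + (\<Sum>k<n. ?f k))" for n
  proof (induction n)
    case 0
    show ?case by (simp add: laurent_coeff_def qterm_def)
  next
    case (Suc n)
    have "{- int (Suc n)..int (Suc n)} = insert (- int (Suc n)) (insert (int (Suc n)) {- int n..int n})"
      by auto
    hence "(\<Sum>k\<in>{- int (Suc n)..int (Suc n)}. ?g k) =
      ?g (- int (Suc n)) + (?g (int (Suc n)) + (\<Sum>k\<in>{- int n..int n}. ?g k))" by simp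
    also have "?g (- int (Suc n)) + (?g (int (Suc n)) + (\<Sum>k\<in>{- int n..int n}. ?g k)) =
        ?C * (1 + (\<Sum>k<Suc n. ?f k))"
      unfolding Suc unfolding laurent_coeff_def by (simp del: of_nat_Suc add: algebra_simps)
    finally show ?case .
  qed
  have "(\<lambda>n. \<Sum>k<n. ?f k) \<longlonglongrightarrow> (\<Sum>k. ?f k)"
    using summable_LIMSEQ[OF summable_norm_cancel[OF q_dixon(1)[of a b c]]] assms by simp
  thus ?thesis unfolding eq by (intro tendsto_intros)
qed

end

section \<open>Integration over the torus\<close>

lemma circlepath_0_1: "circlepath 0 1 t = exp (2 * of_real pi * \<i> * of_real t)"
  by (simp add: circlepath)

lemma norm_circlepath_0_1: "norm (circlepath 0 1 t) = 1"
  by (simp add: circlepath_0_1)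

lemma circlepath_0_1_nonzero: "circlepath 0 1 t \<noteq> 0"
  by (simp add: circlepath_0_1)

abbreviation unit_interval_measure :: "real measure" where
  "unit_interval_measure \<equiv> restrict_space lborel {0..1}"

lemma circlepath_0_1_powi: "circlepath 0 1 t powi k = exp (2 * of_real pi * \<i> * of_int k * of_real t)"
  by (simp add: circlepath_0_1 exp_power_int mult_ac)

lemma finite_measure_unit_interval: "finite_measure unit_interval_measure"
  by (rule finite_measureI) (simp add: emeasure_restrict_space space_restrict_space)

lemma circlepath_powi_integrable:
  "integrable unit_interval_measure (\<lambda>t. circlepath 0 1 t powi k)"
proof (rule finite_measure.integrable_const_bound[OF finite_measure_unit_interval, where B = 1])
  show "(\<lambda>t. circlepath 0 1 t powi k) \<in> borel_measurable unit_interval_measure"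
    unfolding circlepath_0_1_powi
    by (simp add: measurable_restrict_space1 borel_measurable_continuous_onI continuous_intros)
qed (simp add: norm_power_int norm_circlepath_0_1)

lemma circlepath_powi_integral:
  "integral\<^sup>L unit_interval_measure (\<lambda>t. circlepath 0 1 t powi k) = (if k = 0 then 1 else 0)"
proof (cases "k = 0")
  case True
  thus ?thesis by (simp add: measure_restrict_space space_restrict_space)
next
  case False
  define c where "c = 2 * of_real pi * \<i> * of_int k"
  have c: "c \<noteq> 0" using False by (simp add: c_def)
  have eq: "circlepath 0 1 t powi k = exp (c * of_real t)" for t
    by (simp add: circlepath_0_1_powi c_def)
  have "integral\<^sup>L unit_interval_measure (\<lambda>t. circlepath 0 1 t powi k) =
    (\<integral>t. indicator {0..1} t *\<^sub>R exp (c * of_real t) \<partial>lborel)"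
    unfolding eq by (rule integral_restrict_space) simp
  also have "\<dots> = exp (c * of_real 1) / c - exp (c * of_real 0) / c"
  proof (rule integral_FTC_atLeastAtMost)
    show "((\<lambda>t. exp (c * of_real t) / c) has_vector_derivative exp (c * of_real x))
        (at x within {0..1})" for x
      by (rule has_vector_derivative_real_field[where f = "\<lambda>w. exp (c * w) / c"])
        (use c in \<open>auto intro!: derivative_eq_intros\<close>)
  qed (auto intro!: continuous_intros)
  also have "exp (c * of_real 1) = 1"
    unfolding c_def exp_eq_1 by (auto intro!: exI[of _ k])
  finally show ?thesis using False by simp
qed

interpretation unit_cube: product_sigma_finite "\<lambda>_ :: nat. unit_interval_measure"
  using finite_measure_unit_interval
  by (simp add: product_sigma_finite_def finite_measure_def)

abbreviation unit_cube_measure :: "(nat \<Rightarrow> real) measure" where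
  "unit_cube_measure \<equiv> Pi\<^sub>M {1..3} (\<lambda>_. unit_interval_measure)"

lemma prod_1_3: "(\<Prod>i = 1..3::nat. f i) = f 1 * f 2 * (f 3 :: 'a :: comm_monoid_mult)"
  by (simp add: eval_nat_numeral prod.atLeast_Suc_atMost_Suc_shift mult.assoc)

lemma monomial_integral:
  fixes k l m :: int
  defines "f \<equiv> (\<lambda>t. circlepath 0 1 (t 1) powi k * circlepath 0 1 (t 2) powi l *
      circlepath 0 1 (t 3) powi m)"
  shows "integrable unit_cube_measure f"
    and "integral\<^sup>L unit_cube_measure f = (if k = 0 \<and> l = 0 \<and> m = 0 then 1 else 0)"
proof -
  define p where "p i = (if i = 1 then k else if i = 2 then l else m)" for i :: nat
  have f: "f = (\<lambda>t. \<Prod>i=1..3. circlepath 0 1 (t i) powi p i)"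
    unfolding f_def prod_1_3 p_def by simp
  show "integrable unit_cube_measure f"
    unfolding f by (intro unit_cube.product_integrable_prod circlepath_powi_integrable) simp
  have "integral\<^sup>L unit_cube_measure f =
      (\<Prod>i=1..3. integral\<^sup>L unit_interval_measure (\<lambda>t. circlepath 0 1 t powi p i))"
    unfolding f by (intro unit_cube.product_integral_prod circlepath_powi_integrable) simp
  also have "\<dots> = (if k = 0 \<and> l = 0 \<and> m = 0 then 1 else 0)"
    unfolding circlepath_powi_integral prod_1_3 by (simp add: p_def)
  finally show "integral\<^sup>L unit_cube_measure f = (if k = 0 \<and> l = 0 \<and> m = 0 then 1 else 0)" .
qed

lemma unit_cube_integrable_const: "integrable unit_cube_measure (\<lambda>_. c :: real)"
proof -
  have "integrable unit_interval_measure (\<lambda>_. 1 :: real)"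
    by (rule finite_measure.integrable_const[OF finite_measure_unit_interval])
  hence "integrable unit_cube_measure (\<lambda>t. \<Prod>i\<in>{1..3::nat}. 1 :: real)"
    by (intro unit_cube.product_integrable_prod) simp_all
  from integrable_mult_right[OF this, of c] show ?thesis by simp
qed

section \<open>The torus integral of the product of three kernels\<close>

context q_base begin

text \<open>As in the theorem, each parameter belongs to the pair of the two other indices.\<close>

definition trig_poly :: "complex \<Rightarrow> complex \<Rightarrow> complex \<Rightarrow> nat \<Rightarrow> (nat \<Rightarrow> complex) \<Rightarrow> complex" where
  "trig_poly a b c n y =
     laurent_sum c n (y 1 / y 2) * laurent_sum b n (y 1 / y 3) * laurent_sum a n (y 2 / y 3)"

text \<open>A monomial survives only if k + l = 0, m - k = 0 and l + m = 0. One free index k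
  remains, with m = k and l = -k, so the pair (1,3) alone receives the negative index.\<close>

lemma trig_poly_integral:
  shows "integrable unit_cube_measure (\<lambda>t. trig_poly a b c n (\<lambda>i. circlepath 0 1 (t i)))"
    and "(\<integral>t. trig_poly a b c n (\<lambda>i. circlepath 0 1 (t i)) \<partial>unit_cube_measure) =
      (\<Sum>k\<in>{- int n..int n}. laurent_coeff c k * laurent_coeff a k * laurent_coeff b (- k))"
proof -
  let ?I = "{- int n..int n}"
  let ?m = "\<lambda>k l m t. circlepath 0 1 (t (1::nat)) powi (k + l) * circlepath 0 1 (t 2) powi (m - k) *
      circlepath 0 1 (t 3) powi (- l - m)"
  have eq: "trig_poly a b c n (\<lambda>i. circlepath 0 1 (t i)) =
    (\<Sum>k\<in>?I. \<Sum>l\<in>?I. \<Sum>m\<in>?I. laurent_coeff c k * laurent_coeff b l * laurent_coeff a m * ?m k l m t)" for t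
  proof -
    define u v w where "u = circlepath 0 1 (t 1)" and "v = circlepath 0 1 (t 2)"
        and "w = circlepath 0 1 (t 3)"
    have nz: "u \<noteq> 0" "v \<noteq> 0" "w \<noteq> 0" by (simp_all add: u_def v_def w_def circlepath_0_1_nonzero)
    have "trig_poly a b c n (\<lambda>i. circlepath 0 1 (t i)) =
      (\<Sum>k\<in>?I. \<Sum>l\<in>?I. \<Sum>m\<in>?I. laurent_coeff c k * (u / v) powi k *
        (laurent_coeff b l * (u / w) powi l * (laurent_coeff a m * (v / w) powi m)))"
      unfolding trig_poly_def laurent_sum_def u_def v_def w_def
      unfolding mult.assoc[of "sum _ _"]
      unfolding sum_distrib_right
      unfolding sum_distrib_left ..
    also have "\<dots> = (\<Sum>k\<in>?I. \<Sum>l\<in>?I. \<Sum>m\<in>?I. laurent_coeff c k * laurent_coeff b l * laurent_coeff a m *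
        (u powi (k + l) * v powi (m - k) * w powi (- l - m)))"
      using nz
      by (intro sum.cong refl)
        (simp add: power_int_add power_int_diff power_int_minus power_int_divide_distrib field_simps)
    finally show ?thesis unfolding u_def v_def w_def .
  qed
  show "integrable unit_cube_measure (\<lambda>t. trig_poly a b c n (\<lambda>i. circlepath 0 1 (t i)))"
    unfolding eq by (intro Bochner_Integration.integrable_sum integrable_mult_right monomial_integral)
  have "(\<integral>t. trig_poly a b c n (\<lambda>i. circlepath 0 1 (t i)) \<partial>unit_cube_measure) =
    (\<Sum>k\<in>?I. \<Sum>l\<in>?I. \<Sum>m\<in>?I. laurent_coeff c k * laurent_coeff b l * laurent_coeff a m *
      (\<integral>t. ?m k l m t \<partial>unit_cube_measure))"
    unfolding eq
    by (subst Bochner_Integration.integral_sum |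
        (intro Bochner_Integration.integrable_sum integrable_mult_right monomial_integral)[1] |
        intro sum.cong refl integral_mult_right_zero)+
  also have "\<dots> = (\<Sum>k\<in>?I. \<Sum>l\<in>?I. \<Sum>m\<in>?I. if m = k then (if l = - k then
      laurent_coeff c k * laurent_coeff b l * laurent_coeff a m else 0) else 0)"
    unfolding monomial_integral(2) by (intro sum.cong refl) auto
  also have "\<dots> = (\<Sum>k\<in>?I. \<Sum>l\<in>?I. if l = - k then laurent_coeff c k * laurent_coeff b l *
      laurent_coeff a k else 0)"
    by (intro sum.cong refl) (simp add: sum.delta)
  also have "\<dots> = (\<Sum>k\<in>?I. laurent_coeff c k * laurent_coeff a k * laurent_coeff b (- k))"
    by (intro sum.cong refl) (auto simp: sum.delta mult_ac)
  finally show "(\<integral>t. trig_poly a b c n (\<lambda>i. circlepath 0 1 (t i)) \<partial>unit_cube_measure) =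
      (\<Sum>k\<in>?I. laurent_coeff c k * laurent_coeff a k * laurent_coeff b (- k))" .
qed

definition kernel :: "complex \<Rightarrow> complex \<Rightarrow> complex" where
  "kernel z x = qp x * qp (Q / x) / (qp (z * x) * qp (z * (Q / x)))"

text \<open>On the torus the truncations converge pointwise and are bounded by the product of the
  three absolute coefficient sums, a constant, so dominated convergence transfers the finite
  computation to the kernels.\<close>

lemma kernel_integral:
  assumes a: "norm a < 1" and b: "norm b < 1" and c: "norm c < 1"
  shows "(\<integral>t. kernel c (circlepath 0 1 (t 1) / circlepath 0 1 (t 2)) *
      kernel b (circlepath 0 1 (t 1) / circlepath 0 1 (t 3)) *
      kernel a (circlepath 0 1 (t 2) / circlepath 0 1 (t 3)) \<partial>unit_cube_measure) =
    qp (a * Q) * qp (b * Q) * qp (c * Q) * qp (a * b * Q) * qp (a * c * Q) * qp (b * c * Q) /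
    ((qp Q)\<^sup>2 * qp (a * b * c * Q) * (qp (a\<^sup>2 * Q) * qp (b\<^sup>2 * Q) * qp (c\<^sup>2 * Q)))"
    (is "integral\<^sup>L _ ?F = ?R")
proof -
  let ?f = "\<lambda>n t. trig_poly a b c n (\<lambda>i. circlepath 0 1 (t i))"
  define B where "B z = infsum (\<lambda>k. norm (laurent_coeff z k)) UNIV" for z
  have n1: "norm (circlepath 0 1 s / circlepath 0 1 t) = 1" for s t
    by (simp add: norm_divide norm_circlepath_0_1)
  have lim: "(\<lambda>n. ?f n t) \<longlonglongrightarrow> ?F t" for t
    unfolding trig_poly_def kernel_def by (intro tendsto_mult laurent_sum_tendsto a b c n1)
  have meas: "?f n \<in> borel_measurable unit_cube_measure" for n
    using trig_poly_integral(1) by (rule borel_measurable_integrable)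
  have "(\<lambda>n. integral\<^sup>L unit_cube_measure (?f n)) \<longlonglongrightarrow> integral\<^sup>L unit_cube_measure ?F"
  proof (rule integral_dominated_convergence)
    show "?F \<in> borel_measurable unit_cube_measure"
      by (rule borel_measurable_LIMSEQ_metric[OF meas lim])
    show "integrable unit_cube_measure (\<lambda>_. B c * B b * B a)" by (rule unit_cube_integrable_const)
    show "AE t in unit_cube_measure. norm (?f n t) \<le> B c * B b * B a" for n
      unfolding trig_poly_def B_def
      by (intro AE_I2 norm_mult_le laurent_sum_bounded a b c n1)
  qed (use lim meas in auto)
  moreover have "(\<lambda>n. integral\<^sup>L unit_cube_measure (?f n)) \<longlonglongrightarrow>
    const_coeff c * const_coeff a * const_coeff b *
      (1 + (\<Sum>k. Q ^ Suc k * (1 + Q ^ Suc k) * qterm a (Suc k) * qterm b (Suc k) * qterm c (Suc k)))"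
          (is "_ \<longlonglongrightarrow> _ * ?S")
    unfolding trig_poly_integral(2) by (rule laurent_coeff_sum_tendsto[OF c a b])
  ultimately have "integral\<^sup>L unit_cube_measure ?F = const_coeff c * const_coeff a * const_coeff b * ?S"
    by (rule LIMSEQ_unique)
  also have "\<dots> = ?R"
  proof -
    have less_1: "norm (x * y) < 1" if "norm x < 1" "norm y < 1" for x y :: complex
      using that mult_strict_mono'[of "norm x" 1 "norm y" 1] by (simp add: norm_mult)
    have nz: "qp (x * Q) \<noteq> 0" if "norm x < 1" for x
      using that qp_Q_nonzero by simp
    have nzs: "qp (a * Q) \<noteq> 0" "qp (b * Q) \<noteq> 0" "qp (c * Q) \<noteq> 0" "qp (c * a * b * Q) \<noteq> 0"
      "qp (a\<^sup>2 * Q) \<noteq> 0" "qp (b\<^sup>2 * Q) \<noteq> 0" "qp (c\<^sup>2 * Q) \<noteq> 0" "qp Q \<noteq> 0"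
      using qp_Q_nonzero[of 1] by (auto intro!: nz less_1 a b c norm_square_less_1)
    \<comment> \<open>Each constant term contributes the square of \<open>qp (x * Q)\<close> for its
      parameter x; the denominator of the Dixon sum cancels one of the two factors.\<close>
    have S: "?S = qp Q * qp (c * a * Q) * qp (c * b * Q) * qp (a * b * Q) /
        (qp (c * a * b * Q) * qp (c * Q) * qp (a * Q) * qp (b * Q))"
      using q_dixon(2)[of c a b] a b c nzs by (simp add: nonzero_eq_divide_eq)
    have *: "a * b * c = c * a * b" "a * c = c * a" "b * c = c * b" by (simp_all add: mult_ac)
    show ?thesis
      unfolding S const_coeff_def * using nzs by (simp add: divide_simps power2_eq_square mult_ac)
  qed
  finally show ?thesis .
qed

lemma q_poch_kernel:
  assumes "u \<noteq> 0" "v \<noteq> 0"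
  shows "q_poch q (u / v) a * q_poch q (Q * v / u) a = kernel (Q powr a) (u / v)"
  by (simp add: q_poch_def kernel_def mult_ac)

lemma norm_Q_powr_less_1: "Re a > 0 \<Longrightarrow> norm (Q powr a) < 1"
  using q_pos q_less_1 by (simp add: norm_powr_real_powr powr01_less_one)

lemma q_Gamma_add_1:
  "q_Gamma q (a + 1) = of_real (1 - q) powr (- a) * qp Q / qp (Q powr a * Q)"
  by (simp add: q_Gamma_def powr_add)

end

section \<open>Translation to q-shifted factorials and q-Gamma functions\<close>

lemma index_pairs_eq: "index_pairs = {(1, 2), (1, 3), (2, 3)}"
  by (auto simp: index_pairs_def)

lemma third_index_simps: "third_index 1 2 = 3" "third_index 1 3 = 2" "third_index 2 3 = 1"
proof -
  have "{1, 2, 3} - {1, 2} = {3::nat}" "{1, 2, 3} - {1, 3} = {2::nat}" "{1, 2, 3} - {2, 3} = {1::nat}"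
    by auto
  thus "third_index 1 2 = 3" "third_index 1 3 = 2" "third_index 2 3 = 1"
    by (simp_all only: third_index_def the_elem_eq)
qed

theorem theorem1p6:
  fixes q :: real and a :: "nat \<Rightarrow> complex"
  assumes "0 < q" and "q < 1"
    and "\<And>i. i \<in> {1..3} \<Longrightarrow> Re (a i) > 0"
  shows "1 / (2 * of_real pi * \<i>) ^ 3 *
      torus_integral 3 (\<lambda>y.
        (\<Prod>(i, j)\<in>index_pairs.
           q_poch q (y i / y j) (a (third_index i j)) *
           q_poch q (of_real q * y j / y i) (a (third_index i j))) *
        (\<Prod>i=1..3. 1 / y i)) =
    q_Gamma q (a 1 + a 2 + a 3 + 1) * (\<Prod>i=1..3. q_Gamma q (2 * a i + 1)) /
      ((\<Prod>i=1..3. q_Gamma q (a i + 1)) *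
       (\<Prod>(i, j)\<in>index_pairs. q_Gamma q (a i + a j + 1)))"
proof -
  interpret q_base q by standard (fact assms)+
  define z where "z i = Q powr a i" for i
  have z: "norm (z 1) < 1" "norm (z 2) < 1" "norm (z 3) < 1"
    unfolding z_def by (intro norm_Q_powr_less_1 assms(3); simp)+
  let ?F = "\<lambda>t. kernel (z 3) (circlepath 0 1 (t 1) / circlepath 0 1 (t 2)) *
      kernel (z 2) (circlepath 0 1 (t 1) / circlepath 0 1 (t 3)) *
      kernel (z 1) (circlepath 0 1 (t 2) / circlepath 0 1 (t (3::nat)))"
  have integrand: "(\<Prod>(i, j)\<in>index_pairs.
           q_poch q (circlepath 0 1 (t i) / circlepath 0 1 (t j)) (a (third_index i j)) *
           q_poch q (Q * circlepath 0 1 (t j) / circlepath 0 1 (t i)) (a (third_index i j))) *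
        (\<Prod>i=1..3. 1 / circlepath 0 1 (t i)) *
        (\<Prod>i=1..3. vector_derivative (circlepath 0 1) (at (t i))) = (2 * of_real pi * \<i>) ^ 3 * ?F t" for t
  proof -
    \<comment> \<open>On the unit circle dy/y is the constant 2 pi i times dt, so the three forms
      together cancel the prefactor.\<close>
    have "vector_derivative (circlepath 0 1) (at s) = 2 * of_real pi * \<i> * circlepath 0 1 s" for s
      by (simp add: vector_derivative_circlepath circlepath_0_1)
    hence h1: "(\<Prod>i=1..3. 1 / circlepath 0 1 (t i)) *
        (\<Prod>i=1..3. vector_derivative (circlepath 0 1) (at (t i))) =
      (2 * of_real pi * \<i>) ^ 3"
      unfolding prod_1_3 using circlepath_0_1_nonzero by (simp add: power3_eq_cube)
    have h2: "(\<Prod>(i, j)\<in>index_pairs.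
           q_poch q (circlepath 0 1 (t i) / circlepath 0 1 (t j)) (a (third_index i j)) *
           q_poch q (Q * circlepath 0 1 (t j) / circlepath 0 1 (t i)) (a (third_index i j))) = ?F t"
      unfolding index_pairs_eq z_def
      by (simp add: third_index_simps[unfolded One_nat_def] q_poch_kernel circlepath_0_1_nonzero
          mult.assoc)
    show ?thesis unfolding h2 mult.assoc[of "?F t"] h1 by (rule mult.commute)
  qed
  have "1 / (2 * of_real pi * \<i>) ^ 3 *
      torus_integral 3 (\<lambda>y.
        (\<Prod>(i, j)\<in>index_pairs.
           q_poch q (y i / y j) (a (third_index i j)) *
           q_poch q (of_real q * y j / y i) (a (third_index i j))) *
        (\<Prod>i=1..3. 1 / y i)) = integral\<^sup>L unit_cube_measure ?F"
    unfolding torus_integral_def integrand by simp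
  also have "\<dots> = qp (z 1 * Q) * qp (z 2 * Q) * qp (z 3 * Q) *
      qp (z 1 * z 2 * Q) * qp (z 1 * z 3 * Q) * qp (z 2 * z 3 * Q) /
    ((qp Q)\<^sup>2 * qp (z 1 * z 2 * z 3 * Q) * (qp ((z 1)\<^sup>2 * Q) * qp ((z 2)\<^sup>2 * Q) * qp ((z 3)\<^sup>2 * Q)))"
    by (rule kernel_integral[OF z])
  also have "\<dots> = q_Gamma q (a 1 + a 2 + a 3 + 1) * (\<Prod>i=1..3. q_Gamma q (2 * a i + 1)) /
      ((\<Prod>i=1..3. q_Gamma q (a i + 1)) *
       (\<Prod>(i, j)\<in>index_pairs. q_Gamma q (a i + a j + 1)))"
  proof -
    \<comment> \<open>The powers of 1 - q cancel: each \<open>p i\<close> occurs three times in the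
      numerator and three times in the denominator. Of the factors \<open>qp Q\<close> four stand
      above and six below, which accounts for the square in the denominator.\<close>
    define p where "p i = complex_of_real (1 - q) powr (- a i)" for i
    have p: "p i \<noteq> 0" for i using q_less_1 by (simp add: p_def)
    have qp0: "qp Q \<noteq> 0" using qp_Q_nonzero[of 1] by simp
    have G3: "q_Gamma q (a 1 + a 2 + a 3 + 1) = p 1 * p 2 * p 3 * qp Q / qp (z 1 * z 2 * z 3 * Q)"
      unfolding q_Gamma_add_1 p_def z_def minus_add_distrib powr_add ..
    have G2: "q_Gamma q (a i + a j + 1) = p i * p j * qp Q / qp (z i * z j * Q)" for i j
      unfolding q_Gamma_add_1 p_def z_def minus_add_distrib powr_add ..
    have G2': "q_Gamma q (2 * a i + 1) = (p i)\<^sup>2 * qp Q / qp ((z i)\<^sup>2 * Q)" for i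
      unfolding mult_2 G2 by (simp add: power2_eq_square)
    have G1: "q_Gamma q (a i + 1) = p i * qp Q / qp (z i * Q)" for i
      unfolding q_Gamma_add_1 p_def z_def ..
    have pairs: "(\<Prod>(i, j)\<in>index_pairs. f i j) = f 1 2 * f 1 3 * f 2 3" for f :: "nat \<Rightarrow> nat \<Rightarrow> complex"
      unfolding index_pairs_eq by (simp add: mult.assoc)
    show ?thesis
      unfolding G3 G2 G2' G1 prod_1_3 pairs using p qp0
      by (simp add: power2_eq_square mult_ac)
  qed
  finally show ?thesis .
qed

end
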